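(* For any positive integer $a$, the three numbers $1$, $\log(a/(a+1))$, $\log((a+1)/(a+2))$ are linearly independent over $\mathbb{Q}$. More precisely, there exist a positive number $\nu(a)$ and a number $Q_0$ such that for all integers $q, p_1, p_2$ with $Q=\max(|q|,|p_1|,|p_2|) \geq Q_0$, $$ \Bigl|q + p_1\log\frac{a}{a+1} + p_2\log\frac{a+1}{a+2}\Bigr| > \frac{1}{Q^{\nu(a)}} . $$
   Context: $\log$ denotes the natural logarithm. *)

theory Defs
  imports "HOL-Analysis.Analysis"
begin

end

theory Submission
  imports Defs "HOL-Number_Theory.Prime_Powers"
begin

text \<open>
Let \<open>w(x) = (x - a) (x - a - 1) (x - a - 2)\<close>. Integrating \<open>x^j w(x)^n / x^(m+1)\<close> over \<open>[a, a+1]\<close>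
and over \<open>[a+1, a+2]\<close> yields small linear forms in 1 and one logarithm each, both with the same
coefficient of the logarithm; the powers of the end points in the denominators cancel, so that
up to a factor \<open>e^k\<close> the common denominator is the least common multiple of an initial segment
of the integers. For \<open>a \<ge> 3\<close> the exponents \<open>m = n\<close> suffice, but only
with the bound \<open>lcm {1..N} = O(2.97^N)\<close>, proved as in Hanson's \<open>lcm {1..N} < 3^N\<close>. For \<open>a = 2\<close> one takes
\<open>n = 2 k\<close>, \<open>m = 3 k\<close>, exploiting the common factor of 2 and 4, and \<open>a = 1\<close> reduces to \<open>a = 2\<close>
because \<open>ln (1/2) = ln (2/3) + ln (3/4)\<close>.

The forms for \<open>j = 0, 1, 2\<close> are independent: otherwise a quadratic \<open>S \<noteq> 0\<close> would make
both integrals of \<open>S w^n / x^(m+1)\<close> and the coefficient of \<open>x^m\<close> in \<open>S w^n\<close> vanish; the integrals force a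
root of \<open>S\<close> in each interval, so \<open>S w^n\<close> has only positive roots and all its coefficients are nonzero.
\<close>

section \<open>Chebyshev bound for the least common multiple\<close>

text \<open>A single term of the multinomial expansion of \<open>sum p I ^ sum n I\<close> is at
  most the whole. The induction splits off one variable and keeps one term of the binomial
  theorem.\<close>

lemma fact_mult_prod_power_le:
  fixes p :: "'a \<Rightarrow> real" and n :: "'a \<Rightarrow> nat"
  assumes "finite I" "\<And>i. i \<in> I \<Longrightarrow> p i \<ge> 0"
  shows "fact (sum n I) * (\<Prod>i\<in>I. p i ^ n i) \<le> sum p I ^ sum n I * (\<Prod>i\<in>I. fact (n i))"
  using assms
proof (induction I)
  case empty
  show ?case by simp
next
  case (insert x I)
  let ?s = "sum n I" and ?P = "\<Prod>i\<in>I. p i ^ n i" and ?F = "\<Prod>i\<in>I. fact (n i) :: real"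
  have IH: "fact ?s * ?P \<le> sum p I ^ ?s * ?F" using insert by simp
  have p0: "p x \<ge> 0" "sum p I \<ge> 0" using insert.prems by (auto intro: sum_nonneg)
  have "real (n x + ?s choose n x) * p x ^ n x * sum p I ^ (n x + ?s - n x) \<le> 
      (\<Sum>k\<le>n x + ?s. real (n x + ?s choose k) * p x ^ k * sum p I ^ (n x + ?s - k))"
    by (rule member_le_sum) (use p0 in auto)
  also have "\<dots> = (p x + sum p I) ^ (n x + ?s)"
    by (simp add: binomial_ring)
  finally have b: "real (n x + ?s choose n x) * p x ^ n x * sum p I ^ ?s \<le> (p x + sum p I) ^ (n x + ?s)"
    by simp
  have c: "fact (n x + ?s) = real (n x + ?s choose n x) * fact (n x) * fact ?s"
    by (simp add: binomial_fact)
  have "fact (n x + ?s) * (p x ^ n x * ?P)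
      = real (n x + ?s choose n x) * fact (n x) * p x ^ n x * (fact ?s * ?P)"
    by (simp only: c mult_ac)
  also have "\<dots> \<le> real (n x + ?s choose n x) * fact (n x) * p x ^ n x * (sum p I ^ ?s * ?F)"
    by (intro mult_left_mono IH) (use p0 in auto)
  also have "\<dots> = (real (n x + ?s choose n x) * p x ^ n x * sum p I ^ ?s) * (fact (n x) * ?F)"
    by (simp only: mult_ac)
  also have "\<dots> \<le> (p x + sum p I) ^ (n x + ?s) * (fact (n x) * ?F)"
    by (intro mult_right_mono b) (auto intro!: mult_nonneg_nonneg prod_nonneg)
  finally show ?case using insert by simp
qed

definition chebyshev_psi :: "nat \<Rightarrow> real" where
  "chebyshev_psi n = (\<Sum>d\<in>{1..n}. mangoldt d)"

text \<open>Legendre's formula in logarithmic form. Terms with d > n vanish, and the free upper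
  limit \<open>N\<close> lets the factorials of different quotients share one index range.\<close>

lemma ln_fact_eq_sum_mangoldt:
  assumes "n \<le> N"
  shows "ln (fact n) = (\<Sum>d\<in>{1..N}. mangoldt d * real (n div d))"
  using assms
proof (induction n)
  case (Suc n)
  have eq: "Suc n div d = n div d + (if d dvd Suc n then 1 else 0)" for d :: nat
    by (cases "d = 0") (auto simp: div_Suc dvd_eq_mod_eq_0)
  have "ln (fact (Suc n)) = ln (real (Suc n)) + ln (fact n)"
    by (simp add: ln_mult)
  also have "ln (real (Suc n)) = (\<Sum>d | d dvd Suc n. mangoldt d)"
    using mangoldt_sum[of "Suc n", where ?'a = real] by simp
  also have "\<dots> = (\<Sum>d\<in>{1..N}. if d dvd Suc n then mangoldt d else 0)"
    using Suc.prems by (subst sum.inter_filter[symmetric]) 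
      (auto intro!: sum.cong dest: dvd_imp_le simp: Suc_le_eq intro: Nat.gr0I)
  finally have "ln (fact (Suc n)) = (\<Sum>d\<in>{1..N}. (if d dvd Suc n then mangoldt d else 0)
      + mangoldt d * real (n div d))"
    using Suc by (simp add: sum.distrib)
  also have "\<dots> = (\<Sum>d\<in>{1..N}. mangoldt d * real (Suc n div d))"
    by (intro sum.cong refl) (simp add: eq algebra_simps)
  finally show ?case .
qed simp

text \<open>The number is in fact the least common multiple of 1, ..., n. With \<open>h d\<close>
  equal to p at powers of the prime p and to 1 elsewhere, j is the product of \<open>h\<close> over
  its divisors, hence divides the product over all d up to n.\<close>

lemma common_multiple_eq_exp_psi:
  "\<exists>D::nat. D > 0 \<and> real D = exp (chebyshev_psi n) \<and> (\<forall>j\<in>{1..n}. j dvd D)"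
proof -
  define h where "h d = (if primepow d then aprimedivisor d else 1)" for d :: nat
  have h: "h d > 0" "exp (mangoldt d) = real (h d)" if "d > 0" for d
    using that aprimedivisor_pos_nat[of d] primepow_gt_Suc_0[of d]
    by (auto simp: h_def mangoldt_def)
  have "j dvd (\<Prod>d\<in>{1..n}. h d)" if j: "j \<in> {1..n}" for j
  proof -
    have fin: "finite {d. d dvd j}" and sub: "{d. d dvd j} \<subseteq> {1..n}"
      using j by (auto simp: Suc_le_eq intro: dvd_pos_nat[of j] order.trans[OF dvd_imp_le])
    have "real j = exp (\<Sum>d | d dvd j. mangoldt d)"
      using mangoldt_sum[of j, where ?'a = real] j by simp
    also have "\<dots> = real (\<Prod>d | d dvd j. h d)"
      using fin sub h(2) by (simp add: exp_sum subset_iff Suc_le_eq)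
    finally have "j = (\<Prod>d | d dvd j. h d)" by linarith
    also have "\<dots> dvd (\<Prod>d\<in>{1..n}. h d)"
      by (rule prod_dvd_prod_subset) (use sub in auto)
    finally show ?thesis .
  qed
  moreover have "real (\<Prod>d\<in>{1..n}. h d) = exp (chebyshev_psi n)"
    by (simp add: chebyshev_psi_def exp_sum h)
  moreover have "(\<Prod>d\<in>{1..n}. h d) > 0" using h by (auto intro!: prod_pos)
  ultimately show ?thesis by blast
qed

text \<open>
The reciprocals of 2, 3, 7, 43 (the start of Sylvester's sequence) and of their product 1806 sum to 1. Hence
\<open>n!\<close> divided by the factorials of all \<open>n div i\<close> grows only exponentially, while in its logarithm
\<open>mangoldt d\<close> has a positive coefficient whenever \<open>n div d < 1806\<close>.
\<close>

lemma chebyshev_psi_recursive_bound: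
  fixes n :: nat
  assumes n: "n > 0"
  shows "chebyshev_psi n \<le> chebyshev_psi (n div 1806) + 5 * ln (real n)
     + real n * (ln 2 / 2 + ln 3 / 3 + ln 7 / 7 + ln 43 / 43 + ln 1806 / 1806)"
proof -
  define I where "I = {2, 3, 7, 43, 1806 :: nat}"
  define c where "c t = real t - (\<Sum>i\<in>I. real (t div i))" for t :: nat
  have sum_I: "(\<Sum>i\<in>I. f i) = f 2 + f 3 + f 7 + f 43 + f 1806" for f :: "nat \<Rightarrow> real"
    by (simp add: I_def)
  have sum_I': "(\<Sum>i\<in>I. f i) = f 2 + f 3 + f 7 + f 43 + f 1806" for f :: "nat \<Rightarrow> nat"
    by (simp add: I_def)
  have prod_I: "(\<Prod>i\<in>I. f i) = f 2 * f 3 * f 7 * f 43 * f 1806" for f :: "nat \<Rightarrow> real"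
    by (simp add: I_def)
  have le: "real (t div i) \<le> real t / real i" for t i :: nat
    by (rule of_nat_div_le_of_nat)
  have c0: "c t \<ge> 0" for t
    using le[of t 2] le[of t 3] le[of t 7] le[of t 43] le[of t 1806] by (simp add: c_def sum_I)
  \<comment> \<open>The fractions 1/2, 1/3, 1/7, 1/43 sum to 1 - 1/1806 and the last quotient is 0,
    so \<open>c t\<close> is at least t/1806 > 0; being an integer, it is at least 1.\<close>
  have c1: "c t \<ge> 1" if "t > 0" "t < 1806" for t
  proof -
    have "2 * (t div 2) \<le> t" "3 * (t div 3) \<le> t" "7 * (t div 7) \<le> t" "43 * (t div 43) \<le> t"
      by auto
    moreover have "t div 1806 = 0" using that by simp
    ultimately have "t div 2 + t div 3 + t div 7 + t div 43 + t div 1806 + 1 \<le> t" using that by linarith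
    then show ?thesis unfolding c_def sum_I by linarith
  qed
  define N where "N = (\<Sum>i\<in>I. n div i)"
  have N1: "N \<le> n" using c0[of n] by (simp add: c_def N_def flip: of_nat_sum)
  have N2: "n \<le> N + 5" 
  proof -
    have "real n / real i < real (n div i) + 1" if "i > 0" for i
      using that by (metis floor_divide_of_nat_eq floor_correct of_int_add of_int_of_nat_eq of_int_1)
    from this[of 2] this[of 3] this[of 7] this[of 43] this[of 1806]
    have "real n < real N + 5" by (simp add: N_def sum_I')
    then show ?thesis by linarith
  qed
  have "chebyshev_psi n - chebyshev_psi (n div 1806) = (\<Sum>d\<in>{1..n} - {1..n div 1806}. mangoldt d)"
    unfolding chebyshev_psi_def by (subst sum_diff) (auto intro: order.trans[OF _ div_le_dividend])
  also have "\<dots> \<le> (\<Sum>d\<in>{1..n} - {1..n div 1806}. mangoldt d * c (n div d))"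
  proof (rule sum_mono)
    fix d assume d: "d \<in> {1..n} - {1..n div 1806}"
    then have "d > 0" "d \<le> n" "n div 1806 < d" by auto
    then have "n div d > 0" "n div d < 1806"
      by (simp_all add: div_greater_zero_iff div_less_iff_less_mult mult.commute)
    then have "c (n div d) \<ge> 1" by (rule c1)
    then show "mangoldt d \<le> mangoldt d * c (n div d)"
      using mult_left_mono[of 1 "c (n div d)" "mangoldt d"] by (simp add: mangoldt_nonneg)
  qed
  also have "\<dots> \<le> (\<Sum>d\<in>{1..n}. mangoldt d * c (n div d))"
    by (rule sum_mono2) (auto intro: mult_nonneg_nonneg c0 mangoldt_nonneg)
  \<comment> \<open>Since (n div d) div i = (n div i) div d, each part of \<open>c\<close> sums to
    the logarithm of a factorial.\<close>
  also have "\<dots> = ln (fact n) - (\<Sum>i\<in>I. ln (fact (n div i)))"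
  proof -
    have "(\<Sum>d\<in>{1..n}. mangoldt d * c (n div d))
       = (\<Sum>d\<in>{1..n}. mangoldt d * real (n div d)) - (\<Sum>d\<in>{1..n}. \<Sum>i\<in>I. mangoldt d * real ((n div i) div d))"
      by (simp add: c_def right_diff_distrib sum_subtractf sum_distrib_left div_mult2_eq[symmetric] mult.commute)
    also have "(\<Sum>d\<in>{1..n}. \<Sum>i\<in>I. mangoldt d * real ((n div i) div d))
        = (\<Sum>i\<in>I. \<Sum>d\<in>{1..n}. mangoldt d * real ((n div i) div d))"
      by (rule sum.swap)
    also have "\<dots> = (\<Sum>i\<in>I. ln (fact (n div i)))"
      by (intro sum.cong refl ln_fact_eq_sum_mangoldt[symmetric]) simp
    finally show ?thesis using ln_fact_eq_sum_mangoldt[of n n] by simp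
  qed
  \<comment> \<open>Rounding loses less than 1 in each of the five quotients, so n - N is at most 5
    and n! / N! at most n^5. The multinomial bound controls N!, not n!.\<close>
  also have "ln (fact n) \<le> 5 * ln (real n) + ln (fact N)"
  proof -
    have "fact n = (fact n div fact N) * (fact N :: nat)"
      using N1 by (simp add: fact_dvd)
    also have "\<dots> \<le> n ^ (n - N) * fact N"
      using fact_div_fact_le_pow[of "n - N" n] N1 by (intro mult_right_mono) auto
    also have "\<dots> \<le> n ^ 5 * fact N" using n N2 by (intro mult_right_mono power_increasing) auto
    finally have "real (fact n) \<le> real (n ^ 5 * fact N)" by (rule of_nat_mono)
    then have "ln (fact n) \<le> ln (real n ^ 5 * fact N)" using n by simp
    then show ?thesis using n by (simp add: ln_mult ln_realpow)
  qed
  \<comment> \<open>The weights 1/i sum to 1, so the power of their sum in the multinomial bound is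
    1.\<close>
  also have "ln (fact N) \<le> (\<Sum>i\<in>I. ln (fact (n div i))) + (\<Sum>i\<in>I. real (n div i) * ln (real i))"
  proof -
    have pos: "(\<Prod>i\<in>I. (1 / real i) ^ (n div i)) > 0" by (auto intro!: prod_pos simp: I_def)
    have "fact N * (\<Prod>i\<in>I. (1 / real i) ^ (n div i)) \<le> (\<Prod>i\<in>I. fact (n div i))"
      using fact_mult_prod_power_le[of I "\<lambda>i. 1 / real i" "\<lambda>i. n div i"]
      by (simp add: N_def) (simp add: I_def)
    then have "ln (fact N * (\<Prod>i\<in>I. (1 / real i) ^ (n div i))) \<le> ln (\<Prod>i\<in>I. fact (n div i))"
      using pos by (subst ln_le_cancel_iff) (auto intro: prod_pos)
    then show ?thesis using pos
      by (simp add: ln_mult prod_I sum_I ln_realpow ln_div)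
  qed
  also have "(\<Sum>i\<in>I. real (n div i) * ln (real i)) \<le> (\<Sum>i\<in>I. real n / real i * ln (real i))"
    by (intro sum_mono mult_right_mono le) (auto simp: I_def)
  also have "\<dots> = real n * (ln 2 / 2 + ln 3 / 3 + ln 7 / 7 + ln 43 / 43 + ln 1806 / 1806)"
    by (simp add: sum_I algebra_simps)
  finally show ?thesis by simp
qed

text \<open>The left side is about ln 2.952. Iterating the recursive bound through n, n div 1806,
  ... multiplies it by at most 1 + 1/1806 + ... = 1806/1805, which the factor on the right takes
  into account.\<close>

lemma hanson_constant:
  "ln 2 / 2 + ln 3 / 3 + ln 7 / 7 + ln 43 / 43 + ln 1806 / 1806 < (1805 / 1806) * ln (297 / 100 :: real)"
proof -
  have *: "ln x \<le> real k / real n * ln (297 / 100)" if "x > 0" "x ^ n \<le> (297 / 100) ^ k" "n > 0"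
    for x :: real and k n :: nat
  proof -
    have "real n * ln x = ln (x ^ n)" using that by (simp add: ln_realpow)
    also have "\<dots> \<le> ln ((297 / 100) ^ k)" using that by (subst ln_le_cancel_iff) auto
    also have "\<dots> = real k * ln (297 / 100)" by (simp add: ln_realpow)
    finally show ?thesis using that by (simp add: field_simps)
  qed
  \<comment> \<open>Rational bounds for ln x / ln 2.97, each verified by comparing powers such as
    2^36 and 2.97^23. Weighted as in the claim they sum to less than 0.998.\<close>
  have "ln 2 \<le> 23 / 36 * ln (297 / 100 :: real)" "ln 3 \<le> 81 / 80 * ln (297 / 100 :: real)"
    "ln 7 \<le> 34 / 19 * ln (297 / 100 :: real)" "ln 43 \<le> 7 / 2 * ln (297 / 100 :: real)"
    "ln 1806 \<le> 7 * ln (297 / 100 :: real)"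
    using *[of 2 36 23] *[of 3 80 81] *[of 7 19 34] *[of 43 2 7] *[of 1806 1 7]
    by (simp_all add: power_divide)
  moreover have "ln (297 / 100 :: real) > 0" by simp
  ultimately show ?thesis by linarith
qed

text \<open>Strong induction on n. Past \<open>n0\<close> the gap in \<open>hanson_constant\<close>
  absorbs the logarithmic error, so the same \<open>K\<close> survives every step; up to
  \<open>n0\<close> monotonicity gives \<open>K\<close>.\<close>

lemma chebyshev_psi_bound:
  "\<exists>K. \<forall>n. chebyshev_psi n \<le> K + real n * ln (297 / 100)"
proof -
  define A :: real where "A = ln 2 / 2 + ln 3 / 3 + ln 7 / 7 + ln 43 / 43 + ln 1806 / 1806"
  define B :: real where "B = ln (297 / 100)"
  have AB: "A < (1805 / 1806) * B" using hanson_constant by (simp add: A_def B_def)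
  have B0: "B > 0" by (simp add: B_def)
  have "((\<lambda>n. 5 * ln (real n) / real n) \<longlongrightarrow> 0) sequentially"
    using tendsto_mult_right[OF lim_ln_over_n, of 5] by (simp add: mult.commute)
  then have "eventually (\<lambda>n. 5 * ln (real n) / real n < (1805 / 1806) * B - A) sequentially"
    using AB by (intro order_tendstoD(2)) auto
  then obtain n0 where n0: "\<And>n. n \<ge> n0 \<Longrightarrow> 5 * ln (real n) / real n < (1805 / 1806) * B - A"
    by (auto simp: eventually_sequentially)
  have mono: "chebyshev_psi m \<le> chebyshev_psi n" if "m \<le> n" for m n
    unfolding chebyshev_psi_def using that by (intro sum_mono2) (auto simp: mangoldt_nonneg)
  define K where "K = chebyshev_psi n0"
  have "chebyshev_psi n \<le> K + real n * B" for n
  proof (induction n rule: less_induct)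
    case (less n)
    show ?case
    proof (cases "n \<ge> n0 \<and> n > 0")
      case False
      then have "n \<le> n0" by auto
      then show ?thesis using mono[of n n0] B0 by (simp add: K_def add_increasing2)
    next
      case True
      have "5 * ln (real n) < real n * ((1805 / 1806) * B - A)"
        using n0[of n] True by (simp add: field_simps)
      moreover have "chebyshev_psi (n div 1806) \<le> K + real (n div 1806) * B"
        by (rule less) (use True in auto)
      moreover have "real (n div 1806) * B \<le> real n / 1806 * B"
        using B0 of_nat_div_le_of_nat[of n "1806::nat"] by (intro mult_right_mono) auto
      moreover have "chebyshev_psi n \<le> chebyshev_psi (n div 1806) + 5 * ln (real n) + real n * A"
        using chebyshev_psi_recursive_bound[of n] True by (simp add: A_def)
      ultimately show ?thesis by (simp add: algebra_simps)
    qed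
  qed
  then show ?thesis by (auto simp: B_def)
qed

section \<open>Linear independence measures\<close>

text \<open>The constant \<open>c\<close> and the range over all nonzero triples, instead of large
  heights only, make the notion yield linear independence directly and survive integral changes of
  the pair.\<close>

definition has_independence_measure :: "real \<Rightarrow> real \<Rightarrow> bool" where
  "has_independence_measure \<theta>1 \<theta>2 \<longleftrightarrow> (\<exists>c>0. \<exists>\<mu>\<ge>0. \<forall>q p1 p2 :: int. (q, p1, p2) \<noteq> (0, 0, 0) \<longrightarrow>
     \<bar>of_int q + of_int p1 * \<theta>1 + of_int p2 * \<theta>2\<bar> 
       \<ge> c * of_int (max \<bar>q\<bar> (max \<bar>p1\<bar> \<bar>p2\<bar>)) powr -\<mu>)"

text \<open>Multiplying the form L by \<open>A\<close> gives the nonzero integer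
  \<open>q * A + p1 * B + p2 * C\<close> up to an error of order Q K \<rho>^k. Once the error is at
  most 1/2, |A L| is at least 1/2, and |A| is bounded by a power of Q. The triple \<open>A\<close>,
  \<open>B\<close>, \<open>C\<close> may depend on the form.\<close>

lemma has_independence_measure_criterion:
  fixes \<theta>1 \<theta>2 \<rho> R K :: real
  assumes \<rho>: "0 < \<rho>" "\<rho> < 1" and R: "R \<ge> 1" and K: "K \<ge> 1"
    and approx: "\<And>(k::nat) (q::int) (p1::int) (p2::int). (q, p1, p2) \<noteq> (0, 0, 0) \<Longrightarrow>
      \<exists>A B C :: int. \<bar>of_int A\<bar> \<le> K * R ^ k \<and> \<bar>of_int A * \<theta>1 - of_int B\<bar> \<le> K * \<rho> ^ k \<and>
        \<bar>of_int A * \<theta>2 - of_int C\<bar> \<le> K * \<rho> ^ k \<and> q * A + p1 * B + p2 * C \<noteq> 0"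
  shows "has_independence_measure \<theta>1 \<theta>2"
proof -
  define l where "l = - ln \<rho>"
  define \<mu> where "\<mu> = ln R / l"
  define c where "c = 1 / (2 * K * R * (4 * K) powr \<mu>)"
  have l: "l > 0" using \<rho> by (simp add: l_def)
  have \<mu>: "\<mu> \<ge> 0" using l R by (simp add: \<mu>_def)
  have c: "c > 0" using K R by (simp add: c_def)
  have "\<bar>of_int q + of_int p1 * \<theta>1 + of_int p2 * \<theta>2\<bar> 
       \<ge> c * of_int (max \<bar>q\<bar> (max \<bar>p1\<bar> \<bar>p2\<bar>)) powr -\<mu>"
    if nz: "(q, p1, p2) \<noteq> (0, 0, 0)" for q p1 p2 :: int
  proof -
    define Q :: real where "Q = of_int (max \<bar>q\<bar> (max \<bar>p1\<bar> \<bar>p2\<bar>))"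
    define L where "L = of_int q + of_int p1 * \<theta>1 + of_int p2 * \<theta>2"
    have "max \<bar>q\<bar> (max \<bar>p1\<bar> \<bar>p2\<bar>) \<ge> 1" using nz by auto
    then have Q1: "Q \<ge> 1" unfolding Q_def by linarith
    have Qp: "\<bar>of_int p1\<bar> \<le> Q" "\<bar>of_int p2\<bar> \<le> Q" by (simp_all add: Q_def)
    have KQ: "4 * K * Q \<ge> 1" using K Q1 mult_mono[of 1 K 1 Q] by simp
    \<comment> \<open>The real exponent with \<rho>^t = 1 / (4 K Q). Rounding it up to
      \<open>k\<close> costs one factor \<open>R\<close>, which appears in \<open>c\<close>.\<close>
    define t where "t = ln (4 * K * Q) / l"
    have t0: "t \<ge> 0" using KQ l by (simp add: t_def)
    define k where "k = nat \<lceil>t\<rceil>"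
    have k: "t \<le> real k" "real k \<le> t + 1" using t0 unfolding k_def by linarith+
    have "\<rho> ^ k = exp (- (l * real k))"
      using \<rho> by (simp add: l_def exp_of_nat_mult mult.commute)
    also have "\<dots> \<le> exp (- (l * t))" using k l by simp
    also have "\<dots> = 1 / exp (ln (4 * K * Q))" using l by (simp add: t_def exp_minus divide_inverse)
    also have "exp (ln (4 * K * Q)) = 4 * K * Q" using KQ by (intro exp_ln) linarith
    finally have \<rho>k: "Q * (K * \<rho> ^ k) \<le> 1 / 4" using K Q1 by (simp add: field_simps)
    have "R ^ k = R powr real k" using R by (simp add: powr_realpow)
    also have "\<dots> \<le> R powr (t + 1)" using k R by (intro powr_mono) auto
    also have "\<dots> = R * (4 * K * Q) powr \<mu>"
    proof -
      have "R powr t = (4 * K * Q) powr \<mu>"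
        using R K Q1 unfolding powr_def t_def \<mu>_def by simp
      then show ?thesis using R by (simp add: powr_add)
    qed
    also have "\<dots> = R * (4 * K) powr \<mu> * Q powr \<mu>"
      using K Q1 by (simp add: powr_mult)
    finally have "2 * K * R ^ k \<le> 2 * K * (R * (4 * K) powr \<mu> * Q powr \<mu>)" using K by simp
    also have "\<dots> = Q powr \<mu> / c" by (simp add: c_def)
    finally have Rk: "2 * K * R ^ k \<le> Q powr \<mu> / c" .
    from approx[OF nz, of k] obtain A B C :: int where
      A: "\<bar>of_int A\<bar> \<le> K * R ^ k" and B: "\<bar>of_int A * \<theta>1 - of_int B\<bar> \<le> K * \<rho> ^ k"
      and C: "\<bar>of_int A * \<theta>2 - of_int C\<bar> \<le> K * \<rho> ^ k" and nz': "q * A + p1 * B + p2 * C \<noteq> 0"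
      by blast
    have "(1::real) \<le> of_int \<bar>q * A + p1 * B + p2 * C\<bar>" using nz' by linarith
    also have "\<dots> = \<bar>of_int A * L - of_int p1 * (of_int A * \<theta>1 - of_int B)
        - of_int p2 * (of_int A * \<theta>2 - of_int C)\<bar>"
      by (simp add: L_def algebra_simps)
    also have "\<dots> \<le> \<bar>of_int A * L\<bar> + \<bar>of_int p1 * (of_int A * \<theta>1 - of_int B)\<bar>
        + \<bar>of_int p2 * (of_int A * \<theta>2 - of_int C)\<bar>" by linarith
    also have "\<dots> \<le> (K * R ^ k) * \<bar>L\<bar> + Q * (K * \<rho> ^ k) + Q * (K * \<rho> ^ k)"
      unfolding abs_mult using A B C Qp Q1 by (intro add_mono mult_mono) auto
    finally have "1 / 2 \<le> K * R ^ k * \<bar>L\<bar>" using \<rho>k by linarith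
    then have "1 \<le> 2 * K * R ^ k * \<bar>L\<bar>" by linarith
    also have "\<dots> \<le> Q powr \<mu> / c * \<bar>L\<bar>" using Rk by (rule mult_right_mono) simp
    finally have "c \<le> Q powr \<mu> * \<bar>L\<bar>" using c by (simp add: field_simps)
    then show ?thesis using Q1 unfolding L_def[symmetric] Q_def[symmetric]
      by (simp add: powr_minus field_simps)
  qed
  then show ?thesis unfolding has_independence_measure_def using c \<mu> by blast
qed


section \<open>Polynomials with positive roots\<close>

text \<open>The sign pattern of a product of \<open>d\<close> factors x - r with r > 0; in
  particular no coefficient up to index \<open>d\<close> vanishes.\<close>

definition alternating :: "nat \<Rightarrow> real poly \<Rightarrow> bool" where
  "alternating d p \<longleftrightarrow> (\<forall>j\<le>d. (-1) ^ (d + j) * coeff p j > 0) \<and> (\<forall>j>d. coeff p j = 0)"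

lemma alternating_1: "alternating 0 1"
  by (simp add: alternating_def)

lemma alternating_linear_mult:
  assumes "alternating d p" "r > 0"
  shows "alternating (Suc d) ([:-r, 1:] * p)"
proof -
  have c: "coeff ([:-r, 1:] * p) j = (case j of 0 \<Rightarrow> 0 | Suc i \<Rightarrow> coeff p i) - r * coeff p j" for j
    by (cases j) simp_all
  have 1: "(-1) ^ (d + j) * coeff p j \<ge> 0" for j
    using assms(1) unfolding alternating_def by (cases "j \<le> d") (auto intro: less_imp_le)
  have "(-1) ^ (Suc d + j) * coeff ([:-r, 1:] * p) j > 0" if "j \<le> Suc d" for j
  proof (cases j)
    case 0
    moreover have "r * ((-1) ^ d * coeff p 0) > 0" using assms by (auto simp: alternating_def)
    ultimately show ?thesis by (simp add: c mult_ac)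
  next
    case (Suc i)
    then have "(-1) ^ (d + i) * coeff p i > 0" using that assms by (simp add: alternating_def)
    moreover have "r * ((-1) ^ (d + j) * coeff p j) \<ge> 0" using 1 assms by simp
    ultimately show ?thesis unfolding c using Suc by (simp add: algebra_simps)
  qed
  moreover have "coeff ([:-r, 1:] * p) j = 0" if "j > Suc d" for j
    using that assms unfolding c by (auto simp: alternating_def split: nat.split)
  ultimately show ?thesis by (simp add: alternating_def)
qed

lemma poly_eq_sum_atMost:
  fixes p :: "'a :: comm_semiring_1 poly"
  assumes "degree p \<le> d"
  shows "poly p x = (\<Sum>i\<le>d. coeff p i * x ^ i)"
  unfolding poly_altdef
  by (rule sum.mono_neutral_left) (use assms in \<open>auto simp: coeff_eq_0\<close>)

text \<open>At -1 all terms have the same sign, so the absolute value there is the sum of the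
  absolute values of the coefficients.\<close>

lemma alternating_coeff_le:
  assumes "alternating d p"
  shows "\<bar>coeff p j\<bar> \<le> \<bar>poly p (-1)\<bar>"
proof (cases "j \<le> d")
  case True
  have deg: "degree p \<le> d" using assms by (auto simp: alternating_def intro: degree_le)
  have "\<bar>coeff p j\<bar> = \<bar>(-1) ^ (d + j) * coeff p j\<bar>" by (simp add: abs_mult)
  also have "\<dots> = (-1) ^ (d + j) * coeff p j"
    using assms True by (intro abs_of_pos) (simp add: alternating_def)
  also have "\<dots> \<le> (\<Sum>i\<le>d. (-1) ^ (d + i) * coeff p i)"
    using assms True by (intro member_le_sum) (auto simp: alternating_def intro: less_imp_le)
  also have "\<dots> = (-1) ^ d * poly p (-1)"
    by (simp add: poly_eq_sum_atMost [OF deg] sum_distrib_left power_add mult_ac)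
  also have "\<dots> \<le> \<bar>(-1) ^ d * poly p (-1)\<bar>" by (rule abs_ge_self)
  finally show ?thesis by (simp add: abs_mult)
qed (use assms in \<open>auto simp: alternating_def\<close>)


section \<open>Integrals of Laurent polynomials\<close>

text \<open>The termwise antiderivative of \<open>poly p x / x ^ Suc m\<close> without the term j =
  m, which integrates to a logarithm.\<close>

definition rational_part :: "real poly \<Rightarrow> nat \<Rightarrow> real \<Rightarrow> real" where
  "rational_part p m x =
     (\<Sum>j\<in>{..degree p} - {m}. coeff p j * x powi (int j - int m) / (real j - real m))"

lemma has_integral_poly_div_power:
  assumes "0 < u" "u \<le> v"
  shows "((\<lambda>x. poly p x / x ^ Suc m) has_integral
      coeff p m * (ln v - ln u) + rational_part p m v - rational_part p m u) {u..v}"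
proof -
  let ?F = "\<lambda>x. coeff p m * ln x + rational_part p m x"
  have "(?F has_real_derivative poly p x / x ^ Suc m) (at x within {u..v})" if x: "x \<in> {u..v}" for x
  proof -
    have x0: "x > 0" using x assms by auto
    have e: "x powi (int j - int m - 1) = x ^ j / x ^ Suc m" for j
      using x0 by (simp add: power_int_diff)
    have "poly p x / x ^ Suc m = (\<Sum>j\<le>degree p. coeff p j * (x ^ j / x ^ Suc m))"
      by (simp add: poly_altdef sum_divide_distrib)
    \<comment> \<open>If \<open>m\<close> exceeds the degree, the inserted term has coefficient
      0.\<close>
    also have "\<dots> = (\<Sum>j\<in>insert m {..degree p}. coeff p j * (x ^ j / x ^ Suc m))"
      by (rule sum.mono_neutral_left) (auto simp: coeff_eq_0)
    also have "\<dots> = coeff p m * (1 / x) + (\<Sum>j\<in>{..degree p} - {m}. coeff p j * (x ^ j / x ^ Suc m))"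
      using x0 by (subst sum.insert_remove) auto
    finally have eq: "poly p x / x ^ Suc m = \<dots>" .
    have d: "((\<lambda>x. coeff p j * x powi (int j - int m) / (real j - real m)) has_real_derivative
        coeff p j * (x ^ j / x ^ Suc m)) (at x within {u..v})" if "j \<noteq> m" for j
    proof -
      have "((\<lambda>x. x powi (int j - int m)) has_real_derivative
          (real j - real m) * (x ^ j / x ^ Suc m)) (at x within {u..v})"
        using DERIV_power_int[OF DERIV_ident, of "int j - int m" x "{u..v}"] x0 unfolding e by simp
      from DERIV_cmult[OF this, of "coeff p j / (real j - real m)"] that show ?thesis by simp
    qed
    have l: "(ln has_real_derivative 1 / x) (at x within {u..v})"
      using x0 by (auto intro!: derivative_eq_intros)
    show ?thesis unfolding rational_part_def eq
      by (intro DERIV_add DERIV_cmult l DERIV_sum d) auto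
  qed
  then have "((\<lambda>x. poly p x / x ^ Suc m) has_integral ?F v - ?F u) {u..v}"
    using assms by (intro fundamental_theorem_of_calculus) 
      (auto simp: has_real_derivative_iff_has_vector_derivative)
  then show ?thesis by (simp add: algebra_simps)
qed

section \<open>Integrality of the rational parts\<close>

definition integer_poly :: "real poly \<Rightarrow> bool" where
  "integer_poly p \<longleftrightarrow> (\<forall>j. coeff p j \<in> \<int>)"

lemma integer_poly_mult: "integer_poly p \<Longrightarrow> integer_poly q \<Longrightarrow> integer_poly (p * q)"
  by (auto simp: integer_poly_def coeff_mult)

lemma integer_poly_pCons: "c \<in> \<int> \<Longrightarrow> integer_poly p \<Longrightarrow> integer_poly (pCons c p)"
  by (auto simp: integer_poly_def coeff_pCons split: nat.split)

lemma integer_poly_0: "integer_poly 0"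
  by (simp add: integer_poly_def)

lemma integer_poly_smult: "c \<in> \<int> \<Longrightarrow> integer_poly p \<Longrightarrow> integer_poly (smult c p)"
  by (auto simp: integer_poly_def)

lemma integer_poly_power: "integer_poly p \<Longrightarrow> integer_poly (p ^ n)"
  by (induction n) (auto intro: integer_poly_mult integer_poly_pCons integer_poly_0 simp: one_pCons)

text \<open>Hypothesis \<open>G\<close> says that E p(b x) is b^m times an integer polynomial: the
  powers of \<open>b\<close> cancel, and \<open>E\<close> times the j-th numerator is
  \<open>coeff G j\<close>. The remaining denominators j - m have absolute value at most
  \<open>N\<close> and divide \<open>D\<close>.\<close>

lemma rational_part_integral:
  fixes b :: real and D E :: nat
  assumes b: "b > 0" and G: "integer_poly G" "smult (real E) (p \<circ>\<^sub>p [:0, b:]) = smult (b ^ m) G"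
    and D: "\<And>j. j \<in> {1..N} \<Longrightarrow> j dvd D" and N: "m \<le> N" "degree p \<le> N + m"
  shows "real D * real E * rational_part p m b \<in> \<int>"
proof -
  have "real D * real E * rational_part p m b
      = (\<Sum>j\<in>{..degree p} - {m}. coeff G j * (real D / (real j - real m)))"
    unfolding rational_part_def sum_distrib_left
  proof (rule sum.cong)
    fix j
    have "coeff (smult (real E) (p \<circ>\<^sub>p [:0, b:])) j = b ^ m * coeff G j" unfolding G(2) by simp
    then have "real E * (b ^ j * coeff p j) = b ^ m * coeff G j"
      by (simp add: coeff_pcompose_linear)
    then have "real E * (b ^ j * coeff p j) / b ^ m = coeff G j" using b by simp
    moreover have "b powi (int j - int m) = b ^ j / b ^ m" using b by (simp add: power_int_diff)
    ultimately have eq: "real E * (coeff p j * b powi (int j - int m)) = coeff G j"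
      by (simp add: mult_ac)
    show "real D * real E * (coeff p j * b powi (int j - int m) / (real j - real m))
        = coeff G j * (real D / (real j - real m))"
      unfolding eq[symmetric] by simp
  qed simp
  also have "\<dots> \<in> \<int>"
  proof (intro Ints_sum Ints_mult)
    fix j assume j: "j \<in> {..degree p} - {m}"
    show "coeff G j \<in> \<int>" using G by (simp add: integer_poly_def)
    have *: "real D / real i \<in> \<int>" if "i \<in> {1..N}" for i
      using D[OF that] that by (auto elim!: dvdE)
    show "real D / (real j - real m) \<in> \<int>"
    proof (cases "j < m")
      case True
      have "real D / (real j - real m) = - (real D / real (m - j))"
      proof -
        have "real j - real m = - real (m - j)" using True by (simp add: of_nat_diff)
        then show ?thesis by (simp only: minus_divide_right)
      qed
      also have "\<dots> \<in> \<int>" using True N by (intro Ints_minus *) auto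
      finally show ?thesis .
    next
      case False
      then have "real D / (real j - real m) = real D / real (j - m)" by (simp add: of_nat_diff)
      also have "\<dots> \<in> \<int>" using False N j by (intro *) auto
      finally show ?thesis .
    qed
  qed
  finally show ?thesis .
qed

text \<open>By the intermediate value theorem \<open>f\<close> keeps its sign inside, and a
  continuous nonnegative function with integral 0 vanishes identically. Zeros at the end points are
  allowed, as the integrands have them there.\<close>

lemma integral_nonzero:
  fixes f :: "real \<Rightarrow> real"
  assumes "u < v" "continuous_on {u..v} f" "\<And>x. u < x \<Longrightarrow> x < v \<Longrightarrow> f x \<noteq> 0"
  shows "integral {u..v} f \<noteq> 0"
proof -
  have *: "integral {u..v} g \<noteq> 0"
    if g: "continuous_on {u..v} g" "\<And>x. u < x \<Longrightarrow> x < v \<Longrightarrow> g x \<noteq> 0" and pos: "g ((u + v) / 2) > 0" 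
    for g :: "real \<Rightarrow> real"
  proof
    assume int: "integral {u..v} g = 0"
    have nonneg: "g x > 0" if x: "u < x" "x < v" for x
    proof (rule ccontr)
      assume "\<not> g x > 0"
      then have neg: "g x \<le> 0" by simp
      have mid: "u < (u + v) / 2" "(u + v) / 2 < v" using assms(1) by auto
      have "\<exists>y. u < y \<and> y < v \<and> g y = 0"
      proof (cases "x \<le> (u + v) / 2")
        case True
        have "continuous_on {x..(u + v) / 2} g" using x mid by (intro continuous_on_subset[OF g(1)]) auto
        from IVT'[OF neg _ True this] pos obtain y where "x \<le> y" "y \<le> (u + v) / 2" "g y = 0"
          by auto
        then show ?thesis using x mid by (intro exI[of _ y]) linarith
      next
        case False
        have "continuous_on {(u + v) / 2..x} g" using x mid by (intro continuous_on_subset[OF g(1)]) auto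
        from IVT2'[OF neg _ _ this] pos False obtain y where "(u + v) / 2 \<le> y" "y \<le> x" "g y = 0"
          by auto
        then show ?thesis using x mid by (intro exI[of _ y]) linarith
      qed
      then show False using g(2) by blast
    qed
    have "closure {u<..<v} = {u..v}" using assms(1) by simp
    then have "g x \<ge> 0" if "x \<in> {u..v}" for x
      using continuous_ge_on_closure[of "{u<..<v}" g x 0] g(1) that nonneg by (auto intro: less_imp_le)
    then have "\<forall>x\<in>{u..v}. g x = 0" using integral_eq_0_iff[OF g(1) assms(1)] int by simp
    then show False using pos assms(1) by (auto dest!: bspec[of _ _ "(u + v) / 2"])
  qed
  show ?thesis
  proof (cases "f ((u + v) / 2) > 0")
    case True
    then show ?thesis using * assms by blast
  next
    case False
    then have "- f ((u + v) / 2) > 0" using assms(3)[of "(u + v) / 2"] assms(1) by fastforce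
    then have "integral {u..v} (\<lambda>x. - f x) \<noteq> 0"
      using assms by (intro *) (auto intro: continuous_on_minus)
    then show ?thesis by simp
  qed
qed

section \<open>Nonvanishing\<close>

text \<open>A square matrix with a nonzero kernel vector has dependent rows. This converts a
  relation between three functionals into a combination of three polynomials that all the
  functionals annihilate.\<close>

lemma dependent_rows_3:
  fixes x y z :: "3 \<Rightarrow> real"
  assumes "\<And>i. w0 * x i + w1 * y i + w2 * z i = 0" "(w0, w1, w2) \<noteq> (0, 0, 0)"
  obtains s :: "3 \<Rightarrow> real" where "\<exists>i. s i \<noteq> 0"
    "(\<Sum>i\<in>UNIV. s i * x i) = 0" "(\<Sum>i\<in>UNIV. s i * y i) = 0" "(\<Sum>i\<in>UNIV. s i * z i) = 0"
proof -
  define M :: "real^3^3" where "M = (\<chi> i. vector [x i, y i, z i])"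
  define w :: "real^3" where "w = vector [w0, w1, w2]"
  have "M *v w = 0"
    using assms(1) by (simp add: vec_eq_iff matrix_vector_mult_def M_def w_def sum_3 mult.commute)
  moreover have "w \<noteq> 0" using assms(2) by (auto simp: w_def vec_eq_iff forall_3)
  ultimately have "\<not> (\<exists>B. B ** M = mat 1)" by (auto simp: matrix_left_invertible_ker)
  then have "\<not> (\<exists>B. M ** B = mat 1)" using matrix_left_right_inverse by blast
  then obtain s where s: "(\<Sum>i\<in>UNIV. s i *s row i M) = 0" "\<exists>i. s i \<noteq> 0"
    unfolding matrix_right_invertible_independent_rows by blast
  from s(1) have "(\<Sum>i\<in>UNIV. s i *s row i M) $ k = 0" for k by simp
  then have "(\<Sum>i\<in>UNIV. s i * M $ i $ k) = 0" for k by (simp add: row_def)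
  from this[of 1] this[of 2] this[of 3] s(2) show ?thesis
    by (intro that[of s]) (simp_all add: M_def)
qed

section \<open>Integrals as linear functionals and their independence\<close>

definition laurent_integral :: "nat \<Rightarrow> real \<Rightarrow> real \<Rightarrow> real poly \<Rightarrow> real" where
  "laurent_integral m u v p = integral {u..v} (\<lambda>x. poly p x / x ^ Suc m)"

lemma laurent_integral_eq:
  assumes "0 < u" "u \<le> v"
  shows "laurent_integral m u v p =
    coeff p m * (ln v - ln u) + rational_part p m v - rational_part p m u"
  unfolding laurent_integral_def using has_integral_poly_div_power[OF assms] by (rule integral_unique)

lemma continuous_on_poly_div_power:
  fixes p :: "real poly"
  assumes "0 < u"
  shows "continuous_on {u..v} (\<lambda>x. poly p x / x ^ m)"
  using assms by (intro continuous_intros) auto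

lemma laurent_integral_add:
  "0 < u \<Longrightarrow> laurent_integral m u v (p + q) = laurent_integral m u v p + laurent_integral m u v q"
  unfolding laurent_integral_def poly_add add_divide_distrib
  by (intro integral_add integrable_continuous_interval continuous_on_poly_div_power)

lemma laurent_integral_smult:
  "laurent_integral m u v (smult c p) = c * laurent_integral m u v p"
  unfolding laurent_integral_def by (simp flip: times_divide_eq_right)

lemma laurent_integral_eq_0_imp_root:
  assumes "0 < u" "u < v" "laurent_integral m u v (P * S) = 0"
    and "\<And>x. u < x \<Longrightarrow> x < v \<Longrightarrow> poly P x \<noteq> 0"
  obtains x where "u < x" "x < v" "poly S x = 0"
proof -
  have "\<exists>x. u < x \<and> x < v \<and> poly S x = 0"
  proof (rule ccontr)
    assume *: "\<not> (\<exists>x. u < x \<and> x < v \<and> poly S x = 0)"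
    have "laurent_integral m u v (P * S) \<noteq> 0"
      unfolding laurent_integral_def using assms(1,2,4) *
      by (intro integral_nonzero continuous_on_poly_div_power) auto
    then show False using assms(3) by simp
  qed
  then show ?thesis using that by blast
qed

text \<open>A nontrivial relation yields a nonzero quadratic \<open>S\<close> for which the
  coefficient and both integrals of \<open>P * S\<close> vanish. The integrals give \<open>S\<close>
  two positive roots, so \<open>P * S\<close> is a nonzero multiple of an alternating polynomial of
  degree \<open>d + 2\<close>; as \<open>m\<close> is at most \<open>d + 2\<close>, its coefficient
  at \<open>m\<close> is nonzero.\<close>

lemma forms_nonvanishing:
  fixes P :: "real poly"
  assumes b: "0 < b0" "b0 < b1" "b1 < b2"
    and alt: "alternating d P" and m: "m \<le> d + 2"
    and P: "\<And>x. poly P x = 0 \<Longrightarrow> x \<in> {b0, b1, b2}"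
    and eq: "\<And>j. j < 3 \<Longrightarrow> w0 * coeff (monom 1 j * P) m + w1 * laurent_integral m b0 b1 (monom 1 j * P)
       + w2 * laurent_integral m b1 b2 (monom 1 j * P) = 0"
  shows "(w0, w1, w2) = (0, 0, 0)"
proof (rule ccontr)
  assume nz: "(w0, w1, w2) \<noteq> (0, 0, 0)"
  \<comment> \<open>The indices of type \<open>3\<close> are 1, 2 and 3 = 0; they stand for the
    exponents 0, 1, 2.\<close>
  define e :: "3 \<Rightarrow> nat" where "e i = (if i = 1 then 0 else if i = 2 then 1 else 2)" for i
  have e: "e 1 = 0" "e 2 = 1" "e 3 = 2" by (simp_all add: e_def)
  have e3: "e i < 3" for i by (simp add: e_def)
  obtain s where s: "\<exists>i. s i \<noteq> 0"
    "(\<Sum>i\<in>UNIV. s i * coeff (monom 1 (e i) * P) m) = 0"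
    "(\<Sum>i\<in>UNIV. s i * laurent_integral m b0 b1 (monom 1 (e i) * P)) = 0"
    "(\<Sum>i\<in>UNIV. s i * laurent_integral m b1 b2 (monom 1 (e i) * P)) = 0"
    by (rule dependent_rows_3[of w0 "\<lambda>i. coeff (monom 1 (e i) * P) m" w1 
      "\<lambda>i. laurent_integral m b0 b1 (monom 1 (e i) * P)" w2 
      "\<lambda>i. laurent_integral m b1 b2 (monom 1 (e i) * P)", OF eq[OF e3] nz])
  define S where "S = [:s 1, s 2, s 3:]"
  have S0: "S \<noteq> 0" using s(1) forall_3[of "\<lambda>i. s i = 0"] by (auto simp: S_def)
  have PS: "P * S = smult (s 1) (monom 1 (e 1) * P) + (smult (s 2) (monom 1 (e 2) * P)
      + smult (s 3) (monom 1 (e 3) * P))"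
  proof -
    have "S = smult (s 1) (monom 1 0) + (smult (s 2) (monom 1 1) + smult (s 3) (monom 1 2))"
      by (simp add: S_def monom_altdef power2_eq_square)
    then show ?thesis by (simp only: e distrib_left mult_smult_right mult.commute)
  qed
  have c0: "coeff (P * S) m = 0" and J: "laurent_integral m b0 b1 (P * S) = 0" "laurent_integral m b1 b2 (P * S) = 0"
    using s(2-4) b by (simp_all add: PS laurent_integral_add laurent_integral_smult sum_3)
  have "poly P x \<noteq> 0" if "b0 < x" "x < b1" for x using P[of x] that b by auto
  from laurent_integral_eq_0_imp_root[OF _ _ J(1) this] b
  obtain x1 where x1: "b0 < x1" "x1 < b1" "poly S x1 = 0" by auto
  have "poly P x \<noteq> 0" if "b1 < x" "x < b2" for x using P[of x] that b by auto
  from laurent_integral_eq_0_imp_root[OF _ _ J(2) this] b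
  obtain x2 where x2: "b1 < x2" "x2 < b2" "poly S x2 = 0" by auto
  obtain S1 where S1: "S = [:-x1, 1:] * S1" using x1 by (auto simp: poly_eq_0_iff_dvd)
  have "poly S1 x2 = 0" using x1 x2 by (simp add: S1)
  then obtain S2 where S2: "S1 = [:-x2, 1:] * S2" by (auto simp: poly_eq_0_iff_dvd)
  have S20: "S2 \<noteq> 0" using S0 S1 S2 by auto
  have S10: "S1 \<noteq> 0" using S0 S1 by auto
  have "degree S1 = 1 + degree S2"
    unfolding S2 using S20 by (subst degree_mult_eq) auto
  moreover have "degree S = 1 + degree S1"
    unfolding S1 using S10 by (subst degree_mult_eq) auto
  moreover have "degree S \<le> 2" by (simp add: S_def)
  ultimately have "degree S2 = 0" by linarith
  then obtain c where c: "S2 = [:c:]" by (rule degree_eq_zeroE)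
  have "c \<noteq> 0" using S20 c by simp
  have "P * S = smult c ([:-x1, 1:] * ([:-x2, 1:] * P))"
  proof -
    have "P * S = [:c:] * ([:-x1, 1:] * ([:-x2, 1:] * P))"
      unfolding S1 S2 c by (simp only: mult_ac)
    then show ?thesis by (simp only: mult_pCons_left mult_zero_left pCons_0_0 add_0_right)
  qed
  moreover have "alternating (Suc (Suc d)) ([:-x1, 1:] * ([:-x2, 1:] * P))"
    using alt x1 x2 b by (intro alternating_linear_mult) auto
  ultimately have "coeff (P * S) m \<noteq> 0"
    using m \<open>c \<noteq> 0\<close> unfolding alternating_def by fastforce
  then show False using c0 by contradiction
qed

section \<open>Powers of a product of three consecutive factors\<close>

text \<open>The polynomial w of the introduction, kept as a product of linear factors so that
  \<open>alternating_linear_mult\<close> applies.\<close>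

definition consecutive_cubic :: "nat \<Rightarrow> real poly" where
  "consecutive_cubic a = [:- real a, 1:] * ([:- (real a + 1), 1:] * [:- (real a + 2), 1:])"

lemma poly_consecutive_cubic:
  "poly (consecutive_cubic a) x = (x - real a) * (x - (real a + 1)) * (x - (real a + 2))"
  by (simp add: consecutive_cubic_def algebra_simps)

lemma degree_consecutive_cubic: "degree (consecutive_cubic a) = 3"
  by (simp add: consecutive_cubic_def degree_mult_eq del: mult_pCons_left mult_pCons_right)

lemma alternating_consecutive_cubic_power:
  assumes "a > 0"
  shows "alternating (3 * n) (consecutive_cubic a ^ n)"
proof (induction n)
  case (Suc n)
  have eq: "consecutive_cubic a ^ Suc n = [:- real a, 1:] * ([:- (real a + 1), 1:] *
      ([:- (real a + 2), 1:] * consecutive_cubic a ^ n))"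
    by (simp only: power_Suc consecutive_cubic_def mult.assoc)
  have "3 * Suc n = Suc (Suc (Suc (3 * n)))" by simp
  then show ?case unfolding eq
    using Suc assms by (simp only:) (intro alternating_linear_mult; simp)
qed (simp add: alternating_1)

lemma pcompose_power: "(p ^ n) \<circ>\<^sub>p q = (p \<circ>\<^sub>p q :: 'a :: comm_semiring_1 poly) ^ n"
  by (induction n) (simp_all add: pcompose_1 pcompose_mult)

text \<open>The forms come from x^j w^(rk) / x^(sk+1) with j < 3. The differences of exponents reach
  at most tk + 2 in absolute value, by \<open>s \<le> t\<close> below and
  \<open>3 * r \<le> s + t\<close> above; \<open>s \<le> 3 * r\<close> keeps the logarithm's
  coefficient in the alternating range. \<open>e\<close> is the price per k for cancelling the
  powers of the end points, and \<delta> bounds |w|^r / x^s. Hypothesis \<open>small\<close> says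
  that the integrals decay even after the denominators are cleared.\<close>

lemma has_independence_measure_of_cubic_powers:
  fixes a r s t e :: nat and \<delta> :: real
  assumes a: "a > 0" and e: "e > 0" and st: "s \<le> t" "s \<le> 3 * r" "3 * r \<le> s + t"
    and G: "\<And>b. b \<in> {a, a + 1, a + 2} \<Longrightarrow> \<exists>G. integer_poly G \<and>
      smult (real e) ((consecutive_cubic a ^ r) \<circ>\<^sub>p [:0, real b:]) = smult (real b ^ s) G"
    and \<delta>: "\<And>x. real a \<le> x \<Longrightarrow> x \<le> real a + 2 \<Longrightarrow> \<bar>poly (consecutive_cubic a) x\<bar> ^ r \<le> \<delta> * x ^ s"
    and \<delta>0: "\<delta> > 0" and small: "(297 / 100) ^ t * real e * \<delta> < 1"
  shows "has_independence_measure (ln (real a) - ln (real a + 1)) (ln (real a + 1) - ln (real a + 2))"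
proof -
  obtain K0 where K0: "\<And>n. chebyshev_psi n \<le> K0 + real n * ln (297 / 100)"
    using chebyshev_psi_bound by blast
  have K0_0: "K0 \<ge> 0" using K0[of 0] by (simp add: chebyshev_psi_def)
  define c :: real where "c = 297 / 100"
  have c1: "c \<ge> 1" by (simp add: c_def)
  \<comment> \<open>|w(-1)|, which bounds the coefficients of the powers of w.\<close>
  define M :: real where "M = (real a + 1) * (real a + 2) * (real a + 3)"
  have M1: "M \<ge> 1" 
  proof -
    have "1 \<le> real ((a + 1) * (a + 2) * (a + 3))" by (subst real_of_nat_ge_one_iff) auto
    also have "\<dots> = M" by (simp add: M_def algebra_simps)
    finally show ?thesis .
  qed
  \<comment> \<open>\<open>c ^ 2\<close> accounts for the 2 in tk + 2, and the last factor bounds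
    x^j on the intervals.\<close>
  define K where "K = exp K0 * c ^ 2 * (real a + 2) ^ 2"
  have K1: "exp K0 * c ^ 2 \<ge> 1"
    using mult_mono[of 1 "exp K0" 1 "c ^ 2"] K0_0 c1 by simp
  have K2: "(real a + 2) ^ 2 \<ge> 1" by (intro one_le_power) auto
  have K: "K \<ge> exp K0 * c ^ 2"
    using mult_left_mono[OF K2, of "exp K0 * c ^ 2"] by (simp only: K_def mult_1_right) auto
  then have K': "K \<ge> 1" using K1 by linarith
  let ?\<theta>1 = "ln (real a) - ln (real a + 1)" and ?\<theta>2 = "ln (real a + 1) - ln (real a + 2)"
  show ?thesis
  proof (rule has_independence_measure_criterion[where \<rho> = "c ^ t * real e * \<delta>" and R = "c ^ t * real e * M ^ r" and K = K])
    show "0 < c ^ t * real e * \<delta>" using c1 e \<delta>0 by simp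
    show "c ^ t * real e * \<delta> < 1" using small by (simp add: c_def)
    have "1 * 1 * 1 \<le> c ^ t * real e * M ^ r"
      using c1 e M1 by (intro mult_mono one_le_power) (auto simp: Suc_le_eq)
    then show "c ^ t * real e * M ^ r \<ge> 1" by simp
    show "K \<ge> 1" by (rule K')
  next
    fix k :: nat and q p1 p2 :: int
    assume nz: "(q, p1, p2) \<noteq> (0, 0, 0)"
    define P where "P = consecutive_cubic a ^ (r * k)"
    define m where "m = s * k"
    define E where "E = e ^ k"
    define T where "T j = monom 1 j * P" for j
    obtain D :: nat where D: "D > 0" "real D = exp (chebyshev_psi (t * k + 2))"
      "\<And>j. j \<in> {1..t * k + 2} \<Longrightarrow> j dvd D"
      using common_multiple_eq_exp_psi by blast
    have alt: "alternating (3 * (r * k)) P" unfolding P_def by (rule alternating_consecutive_cubic_power[OF a])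
    have DE0: "real D * real E > 0" using D e by (simp add: E_def)
    have "real D \<le> exp (K0 + real (t * k + 2) * ln c)" using K0[of "t * k + 2"] D(2) by (simp add: c_def)
    also have "\<dots> = exp K0 * c ^ (t * k + 2)"
      using c1 by (simp only: exp_add exp_of_nat_mult) simp
    also have "\<dots> = exp K0 * c ^ 2 * (c ^ t) ^ k" by (simp add: power_add power_mult power2_eq_square)
    finally have "real D * real E \<le> exp K0 * c ^ 2 * (c ^ t) ^ k * real E" by (rule mult_right_mono) simp
    then have DE: "real D * real E \<le> exp K0 * c ^ 2 * (c ^ t * real e) ^ k"
      by (simp add: E_def power_mult_distrib)

    \<comment> \<open>Everything is scaled by \<open>D * E\<close> to become integral. As
      \<open>\<theta>1\<close> and \<open>\<theta>2\<close> are ln u - ln v on the interval from u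
      to v, \<open>A j * \<theta> - B j\<close>, and likewise with \<open>C j\<close>, is minus the
      scaled integral.\<close>
    define A where "A j = real D * real E * coeff (T j) m" for j
    define rp where "rp j b = real D * real E * rational_part (T j) m b" for j b
    define B where "B j = rp j (real a + 1) - rp j (real a)" for j
    define C where "C j = rp j (real a + 2) - rp j (real a + 1)" for j
    have Aeq1: "A j * ?\<theta>1 - B j = - (real D * real E * laurent_integral m (real a) (real a + 1) (T j))" for j
      using a by (simp add: A_def B_def rp_def laurent_integral_eq algebra_simps)
    have Aeq2: "A j * ?\<theta>2 - C j = - (real D * real E * laurent_integral m (real a + 1) (real a + 2) (T j))" for j
      using a by (simp add: A_def C_def rp_def laurent_integral_eq algebra_simps)

    have int_cubic: "integer_poly (consecutive_cubic a)"
      unfolding consecutive_cubic_def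
      by (intro integer_poly_mult integer_poly_pCons integer_poly_0) auto
    have int_monom: "integer_poly (monom 1 j)" for j
      by (auto simp: integer_poly_def)
    have A_int: "A j \<in> \<int>" for j
      using integer_poly_mult[OF int_monom[of j] integer_poly_power[OF int_cubic, of "r * k"]]
      by (auto simp: A_def T_def P_def integer_poly_def)
    have rp_int: "rp j (real b) \<in> \<int>" if b: "b \<in> {a, a + 1, a + 2}" and j: "j < 3" for b j
    proof -
      from G[OF b] obtain G where G: "integer_poly G"
        "smult (real e) ((consecutive_cubic a ^ r) \<circ>\<^sub>p [:0, real b:]) = smult (real b ^ s) G" by blast
      have 1: "integer_poly (monom 1 j \<circ>\<^sub>p [:0, real b:])"
        by (auto simp: integer_poly_def coeff_pcompose_linear)
      have "smult (real E) (P \<circ>\<^sub>p [:0, real b:]) 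
          = (smult (real e) ((consecutive_cubic a ^ r) \<circ>\<^sub>p [:0, real b:])) ^ k"
        by (simp add: P_def E_def power_mult pcompose_power smult_power)
      also have "\<dots> = smult (real b ^ m) (G ^ k)"
        by (simp add: G(2) m_def power_mult smult_power)
      finally have "smult (real E) (T j \<circ>\<^sub>p [:0, real b:])
          = smult (real b ^ m) ((monom 1 j \<circ>\<^sub>p [:0, real b:]) * G ^ k)"
        by (simp only: T_def pcompose_mult flip: mult_smult_right)
      moreover have "degree (T j) \<le> t * k + 2 + m"
      proof -
        have "degree (T j) \<le> j + 3 * (r * k)"
          unfolding T_def P_def
          by (intro order.trans[OF degree_mult_le] add_mono degree_monom_le
              order.trans[OF degree_power_le]) (simp add: degree_consecutive_cubic)
        also have "3 * r * k \<le> (s + t) * k" using st by (intro mult_right_mono) auto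
        then have "j + 3 * (r * k) \<le> t * k + 2 + m" using j by (simp add: m_def algebra_simps)
        finally show ?thesis .
      qed
      moreover have "m \<le> t * k + 2" 
        using mult_le_mono1[OF st(1), of k] unfolding m_def by (rule le_trans) simp
      ultimately show ?thesis unfolding rp_def using b a
        by (intro rational_part_integral[OF _ integer_poly_mult[OF 1 integer_poly_power[OF G(1)]] _ D(3)]) auto
    qed
    have rp_int': "rp j (real a) \<in> \<int>" "rp j (real a + 1) \<in> \<int>" "rp j (real a + 2) \<in> \<int>" if "j < 3" for j
      using rp_int[of a j] rp_int[of "a + 1" j] rp_int[of "a + 2" j] that by (simp_all add: add.commute)

    have "\<exists>j<3. of_int q * A j + of_int p1 * B j + of_int p2 * C j \<noteq> 0"
    proof (rule ccontr)
      assume "\<not> (\<exists>j<3. of_int q * A j + of_int p1 * B j + of_int p2 * C j \<noteq> 0)"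
      then have z: "of_int q * A j + of_int p1 * B j + of_int p2 * C j = 0" if "j < 3" for j
        using that by blast
      \<comment> \<open>Eliminating \<open>B\<close> and \<open>C\<close> in favour of the integrals
        leaves a relation with weights \<open>L\<close>, \<open>p1\<close>, \<open>p2\<close>. If
        all weights vanish, then so does \<open>q\<close>.\<close>
      define L where "L = of_int q + of_int p1 * ?\<theta>1 + of_int p2 * ?\<theta>2"
      have "L * coeff (T j) m + of_int p1 * laurent_integral m (real a) (real a + 1) (T j)
          + of_int p2 * laurent_integral m (real a + 1) (real a + 2) (T j) = 0" if "j < 3" for j
      proof -
        have "real D * real E * (L * coeff (T j) m + of_int p1 * laurent_integral m (real a) (real a + 1) (T j)
          + of_int p2 * laurent_integral m (real a + 1) (real a + 2) (T j))
          = L * A j - of_int p1 * (A j * ?\<theta>1 - B j) - of_int p2 * (A j * ?\<theta>2 - C j)"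
          unfolding Aeq1 Aeq2 by (simp add: A_def algebra_simps)
        also have "\<dots> = of_int q * A j + of_int p1 * B j + of_int p2 * C j"
          by (simp add: L_def algebra_simps)
        finally show ?thesis using z[OF that] DE0 by auto
      qed
      moreover have "m \<le> 3 * (r * k) + 2"
        using mult_le_mono1[OF st(2), of k] unfolding m_def mult.assoc by (rule le_trans) simp
      moreover have "x \<in> {real a, real a + 1, real a + 2}" if "poly P x = 0" for x
        using that by (auto simp: P_def poly_consecutive_cubic)
      ultimately have "(L, real_of_int p1, real_of_int p2) = (0, 0, 0)"
        using forms_nonvanishing[of "real a" "real a + 1" "real a + 2" "3 * (r * k)" P m L "real_of_int p1" "real_of_int p2"]
          alt a unfolding T_def by auto
      then show False using nz by (auto simp: L_def)
    qed
    then obtain j where j: "j < 3" and nz': "of_int q * A j + of_int p1 * B j + of_int p2 * C j \<noteq> 0" by blast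
    obtain A' where A': "A j = of_int A'" using A_int[of j] by (auto elim: Ints_cases)
    obtain B' where B': "B j = of_int B'" using rp_int'[OF j] unfolding B_def by (metis Ints_cases Ints_diff)
    obtain C' where C': "C j = of_int C'" using rp_int'[OF j] unfolding C_def by (metis Ints_cases Ints_diff)

    have A_le: "\<bar>A j\<bar> \<le> K * (c ^ t * real e * M ^ r) ^ k"
    proof -
      have "\<bar>coeff (T j) m\<bar> \<le> \<bar>poly P (-1)\<bar>"
        using alternating_coeff_le[OF alt] by (simp add: T_def coeff_monom_mult)
      also have "poly P (-1) = (- M) ^ (r * k)"
        by (simp add: P_def poly_consecutive_cubic M_def) (simp add: algebra_simps)
      also have "\<bar>\<dots>\<bar> = (M ^ r) ^ k" using M1 by (simp add: power_abs power_mult)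
      finally have coeff: "\<bar>coeff (T j) m\<bar> \<le> (M ^ r) ^ k" .
      have "\<bar>A j\<bar> = (real D * real E) * \<bar>coeff (T j) m\<bar>" by (simp add: A_def abs_mult)
      also have "\<dots> \<le> (exp K0 * c ^ 2 * (c ^ t * real e) ^ k) * (M ^ r) ^ k"
        by (rule mult_mono[OF DE coeff]) (use c1 in auto)
      also have "\<dots> = exp K0 * c ^ 2 * (c ^ t * real e * M ^ r) ^ k"
        by (simp add: power_mult_distrib)
      also have "\<dots> \<le> K * (c ^ t * real e * M ^ r) ^ k"
        using c1 M1 by (intro mult_right_mono K) auto
      finally show ?thesis .
    qed
    have J_le: "\<bar>real D * real E * laurent_integral m u (u + 1) (T j)\<bar> \<le> K * (c ^ t * real e * \<delta>) ^ k"
      if u: "real a \<le> u" "u + 1 \<le> real a + 2" for u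
    proof -
      have "\<bar>poly (T j) x / x ^ Suc m\<bar> \<le> \<delta> ^ k * (real a + 2) ^ 2" if x: "x \<in> {u..u + 1}" for x
      proof -
        have x1: "x \<ge> 1" "x \<le> real a + 2" using a x u by (auto simp: Suc_le_eq)
        have "\<bar>poly P x\<bar> = (\<bar>poly (consecutive_cubic a) x\<bar> ^ r) ^ k"
          by (simp add: P_def power_abs power_mult)
        also have "\<dots> \<le> (\<delta> * x ^ s) ^ k" using x u by (intro power_mono \<delta>) auto
        also have "\<dots> = \<delta> ^ k * x ^ m" by (simp add: power_mult_distrib m_def power_mult)
        finally have P: "\<bar>poly P x\<bar> \<le> \<delta> ^ k * x ^ m" .
        have "x ^ j \<le> x ^ 2" using x1 j by (intro power_increasing) auto
        also have "\<dots> \<le> (real a + 2) ^ 2" using x1 by (intro power_mono) auto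
        \<comment> \<open>The denominator is x^(m+1) while \<delta>^k compares with x^m; the spare
          power is harmless because x is at least 1.\<close>
        also have "\<dots> \<le> (real a + 2) ^ 2 * x" using x1 by simp
        finally have "x ^ j * \<bar>poly P x\<bar> \<le> ((real a + 2) ^ 2 * x) * (\<delta> ^ k * x ^ m)"
          using P x1 by (intro mult_mono) auto
        then show ?thesis using x1
          by (simp add: T_def poly_monom abs_mult divide_le_eq mult_ac)
      qed
      then have J: "norm (laurent_integral m u (u + 1) (T j)) \<le> \<delta> ^ k * (real a + 2) ^ 2 * (u + 1 - u)"
        unfolding laurent_integral_def using u a
        by (intro integral_bound continuous_on_poly_div_power) auto
      have "\<bar>real D * real E * laurent_integral m u (u + 1) (T j)\<bar>
          = (real D * real E) * norm (laurent_integral m u (u + 1) (T j))"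
        by (simp add: abs_mult)
      also have "\<dots> \<le> (exp K0 * c ^ 2 * (c ^ t * real e) ^ k) * (\<delta> ^ k * (real a + 2) ^ 2)"
        by (rule mult_mono[OF DE]) (use J c1 in auto)
      also have "\<dots> = K * (c ^ t * real e * \<delta>) ^ k"
        by (simp add: K_def power_mult_distrib mult_ac)
      finally show ?thesis .
    qed
    have J1: "\<bar>A j * ?\<theta>1 - B j\<bar> \<le> K * (c ^ t * real e * \<delta>) ^ k"
      using J_le[of "real a"] unfolding Aeq1 by simp
    have a2: "real a + 1 + 1 = real a + 2" by simp
    have J2: "\<bar>A j * ?\<theta>2 - C j\<bar> \<le> K * (c ^ t * real e * \<delta>) ^ k"
      using J_le[of "real a + 1"] unfolding Aeq2 abs_minus_cancel a2 by auto
    have "of_int (q * A' + p1 * B' + p2 * C') \<noteq> (0 :: real)"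
      using nz' by (simp add: A' B' C')
    then have "q * A' + p1 * B' + p2 * C' \<noteq> 0" by (metis of_int_0)
    then show "\<exists>A B C :: int. \<bar>of_int A\<bar> \<le> K * (c ^ t * real e * M ^ r) ^ k \<and>
        \<bar>of_int A * ?\<theta>1 - of_int B\<bar> \<le> K * (c ^ t * real e * \<delta>) ^ k \<and>
        \<bar>of_int A * ?\<theta>2 - of_int C\<bar> \<le> K * (c ^ t * real e * \<delta>) ^ k \<and> q * A + p1 * B + p2 * C \<noteq> 0"
      using A_le J1 J2 unfolding A' B' C' by blast
  qed
qed

section \<open>Consecutive logarithms\<close>

lemma pcompose_consecutive_cubic:
  "consecutive_cubic a \<circ>\<^sub>p [:0, b:] = [:- real a, b:] * ([:- (real a + 1), b:] * [:- (real a + 2), b:])"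
proof -
  have "[:c, 1:] \<circ>\<^sub>p [:0, b:] = [:c, b:]" for c by (simp add: pcompose_pCons)
  then show ?thesis by (simp only: consecutive_cubic_def pcompose_mult)
qed

text \<open>At x = b y one linear factor of w is b (y - 1), so one power of \<open>b\<close> cancels
  and e = 1. With t = |x - a - 1|, |w| is t - t^3 and x is at least 4 - t. The constant lies just
  above the maximum of the quotient, and 2.97^2 * 0.1131 < 1, whereas 3 in place of 2.97 would be
  too large.\<close>

lemma has_independence_measure_of_ge_3:
  assumes a: "a \<ge> 3"
  shows "has_independence_measure (ln (real a) - ln (real a + 1)) (ln (real a + 1) - ln (real a + 2))"
proof (rule has_independence_measure_of_cubic_powers[where r = 1 and s = 1 and t = 2 and e = 1 and \<delta> = "1131 / 10000"])
  fix b assume "b \<in> {a, a + 1, a + 2}"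
  then consider "b = a" | "b = a + 1" | "b = a + 2" by auto
  then have "\<exists>G. integer_poly G \<and> consecutive_cubic a \<circ>\<^sub>p [:0, real b:] = smult (real b) G"
  proof cases
    case 1
    have "consecutive_cubic a \<circ>\<^sub>p [:0, real b:]
        = smult (real b) ([:-1, 1:] * ([:- (real a + 1), real b:] * [:- (real a + 2), real b:]))"
    proof -
      have "[:- real a, real b:] = smult (real b) [:-1, 1:]" by (simp add: 1)
      then show ?thesis by (simp only: pcompose_consecutive_cubic mult_smult_left)
    qed
    moreover have "integer_poly ([:-1, 1:] * ([:- (real a + 1), real b:] * [:- (real a + 2), real b:]))"
      by (intro integer_poly_mult integer_poly_pCons integer_poly_0) auto
    ultimately show ?thesis by blast
  next
    case 2
    have "consecutive_cubic a \<circ>\<^sub>p [:0, real b:]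
        = smult (real b) ([:- real a, real b:] * ([:-1, 1:] * [:- (real a + 2), real b:]))"
    proof -
      have "[:- (real a + 1), real b:] = smult (real b) [:-1, 1:]" by (simp add: 2)
      then show ?thesis by (simp only: pcompose_consecutive_cubic mult_smult_left mult_smult_right)
    qed
    moreover have "integer_poly ([:- real a, real b:] * ([:-1, 1:] * [:- (real a + 2), real b:]))"
      by (intro integer_poly_mult integer_poly_pCons integer_poly_0) auto
    ultimately show ?thesis by blast
  next
    case 3
    have "consecutive_cubic a \<circ>\<^sub>p [:0, real b:]
        = smult (real b) ([:- real a, real b:] * ([:- (real a + 1), real b:] * [:-1, 1:]))"
    proof -
      have "[:- (real a + 2), real b:] = smult (real b) [:-1, 1:]" by (simp add: 3)
      then show ?thesis by (simp only: pcompose_consecutive_cubic mult_smult_right)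
    qed
    moreover have "integer_poly ([:- real a, real b:] * ([:- (real a + 1), real b:] * [:-1, 1:]))"
      by (intro integer_poly_mult integer_poly_pCons integer_poly_0) auto
    ultimately show ?thesis by blast
  qed
  then show "\<exists>G. integer_poly G \<and>
      smult (real 1) ((consecutive_cubic a ^ 1) \<circ>\<^sub>p [:0, real b:]) = smult (real b ^ 1) G" by simp
next
  fix x assume x: "real a \<le> x" "x \<le> real a + 2"
  define y where "y = x - (real a + 1)"
  define t where "t = \<bar>y\<bar>"
  have t: "0 \<le> t" "t \<le> 1" using x by (auto simp: y_def t_def)
  have "poly (consecutive_cubic a) x = - (y * (1 - y\<^sup>2))"
    by (simp add: poly_consecutive_cubic y_def power2_eq_square algebra_simps)
  then have "\<bar>poly (consecutive_cubic a) x\<bar> = \<bar>y\<bar> * \<bar>1 - y\<^sup>2\<bar>" by (simp only: abs_minus_cancel abs_mult)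
  also have "\<bar>1 - y\<^sup>2\<bar> = 1 - t\<^sup>2" using t abs_square_le_1[of y] by (simp add: t_def)
  finally have "\<bar>poly (consecutive_cubic a) x\<bar> = t * (1 - t\<^sup>2)" by (simp add: t_def)
  also have "\<dots> \<le> 1131 / 10000 * (4 - t)"
  proof -
    \<comment> \<open>This bounds \<open>t - t^3\<close> by its tangent line at 0.609, near the maximum of \<open>(t - t^3) / (4 - t)\<close>.\<close>
    have "(t - 609 / 1000) ^ 2 * (t + 1218 / 1000) \<ge> 0" using t by simp
    then show ?thesis using t by (simp add: power2_eq_square field_simps)
  qed
  also have "\<dots> \<le> 1131 / 10000 * x" using a by (intro mult_left_mono) (auto simp: y_def t_def)
  finally show "\<bar>poly (consecutive_cubic a) x\<bar> ^ 1 \<le> 1131 / 10000 * x ^ 1" by simp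
qed (use a in \<open>auto simp: power2_eq_square\<close>)

text \<open>For a = 2 the exponents 2k of w and 3k of x exploit the extra factors 2 in w(2x) and
  w(4x); the condition becomes 2.97^3 * 3 / 80 < 1.\<close>

lemma has_independence_measure_of_2: "has_independence_measure (ln 2 - ln 3) (ln 3 - ln 4)"
proof -
  have "has_independence_measure (ln (real 2) - ln (real 2 + 1)) (ln (real 2 + 1) - ln (real 2 + 2))"
  proof (rule has_independence_measure_of_cubic_powers[where r = 2 and s = 3 and t = 3 and e = 3 and \<delta> = "125 / 10000"])
    fix b :: nat assume "b \<in> {2, 2 + 1, 2 + 2}"
    then consider "b = 2" | "b = 3" | "b = 4" by auto
    \<comment> \<open>\<open>k\<close> is a common factor of w(bx): 4, 3, 8 at b = 2, 3, 4. Its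
      square should be divisible by b^3, which fails only at b = 3, by a factor 3; this is where e =
      3 comes from.\<close>
    then have "\<exists>H k n. integer_poly H \<and> consecutive_cubic 2 \<circ>\<^sub>p [:0, real b:] = smult k H
        \<and> 3 * k ^ 2 = real b ^ 3 * real n"
    proof cases
      case 1
      have "consecutive_cubic 2 \<circ>\<^sub>p [:0, real b:] = smult 4 ([:-1, 1:] * ([:-3, 2:] * [:-2, 1:]))"
        unfolding pcompose_consecutive_cubic by (simp add: 1)
      moreover have "3 * 4 ^ 2 = real b ^ 3 * real 6" by (simp add: 1)
      moreover have "integer_poly ([:-1, 1:] * ([:-3, 2:] * [:-2, 1:]))"
        by (intro integer_poly_mult integer_poly_pCons integer_poly_0) auto
      ultimately show ?thesis by blast
    next
      case 2
      have "consecutive_cubic 2 \<circ>\<^sub>p [:0, real b:] = smult 3 ([:-2, 3:] * ([:-1, 1:] * [:-4, 3:]))"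
        unfolding pcompose_consecutive_cubic by (simp add: 2)
      moreover have "3 * 3 ^ 2 = real b ^ 3 * real 1" by (simp add: 2)
      moreover have "integer_poly ([:-2, 3:] * ([:-1, 1:] * [:-4, 3:]))"
        by (intro integer_poly_mult integer_poly_pCons integer_poly_0) auto
      ultimately show ?thesis by blast
    next
      case 3
      have "consecutive_cubic 2 \<circ>\<^sub>p [:0, real b:] = smult 8 ([:-1, 2:] * ([:-3, 4:] * [:-1, 1:]))"
        unfolding pcompose_consecutive_cubic by (simp add: 3)
      moreover have "3 * 8 ^ 2 = real b ^ 3 * real 3" by (simp add: 3)
      moreover have "integer_poly ([:-1, 2:] * ([:-3, 4:] * [:-1, 1:]))"
        by (intro integer_poly_mult integer_poly_pCons integer_poly_0) auto
      ultimately show ?thesis by blast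
    qed
    then obtain H k n where H: "integer_poly H" and eq: "consecutive_cubic 2 \<circ>\<^sub>p [:0, real b:] = smult k H"
      and k: "3 * k ^ 2 = real b ^ 3 * real n" by blast
    have "smult (real 3) ((consecutive_cubic 2 ^ 2) \<circ>\<^sub>p [:0, real b:]) = smult (3 * k ^ 2) (H ^ 2)"
      by (simp add: pcompose_power eq smult_power)
    also have "\<dots> = smult (real b ^ 3) (smult (real n) (H ^ 2))" by (simp add: k)
    finally show "\<exists>G. integer_poly G \<and>
      smult (real 3) ((consecutive_cubic 2 ^ 2) \<circ>\<^sub>p [:0, real b:]) = smult (real b ^ 3) G"
      using integer_poly_smult[OF _ integer_poly_power[OF H, of 2], of "real n"] by auto
  next
    fix x assume x: "real 2 \<le> x" "x \<le> real 2 + 2"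
    define y where "y = x - 3"
    define t where "t = \<bar>y\<bar>"
    have t: "0 \<le> t" "t \<le> 1" using x by (auto simp: y_def t_def)
    have "poly (consecutive_cubic 2) x = - (y * (1 - y\<^sup>2))"
      by (simp add: poly_consecutive_cubic y_def power2_eq_square algebra_simps)
    then have "\<bar>poly (consecutive_cubic 2) x\<bar> = \<bar>y\<bar> * \<bar>1 - y\<^sup>2\<bar>" by (simp only: abs_minus_cancel abs_mult)
    also have "\<bar>1 - y\<^sup>2\<bar> = 1 - t\<^sup>2" using t abs_square_le_1[of y] by (simp add: t_def)
    finally have p: "\<bar>poly (consecutive_cubic 2) x\<bar> = t * (1 - t\<^sup>2)" by (simp add: t_def)
    \<comment> \<open>Again a tangent line of \<open>t - t^3\<close>, now at 0.65.\<close>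
    have "(t - 65 / 100) ^ 2 * (t + 130 / 100) \<ge> 0" using t by simp
    then have "t * (1 - t\<^sup>2) \<le> 54925 / 100000 - 2675 / 10000 * t"
      by (simp add: power2_eq_square field_simps)
    moreover have "t * (1 - t\<^sup>2) \<ge> 0" unfolding p[symmetric] by simp
    ultimately have "(t * (1 - t\<^sup>2)) ^ 2 \<le> (54925 / 100000 - 2675 / 10000 * t) ^ 2"
      by (intro power_mono)
    also have "\<dots> \<le> 125 / 10000 * (3 - t) ^ 3"
    proof -
      \<comment> \<open>The difference of the two sides is a positive combination of these terms
        plus a linear function that is positive for t from 0 to 1.\<close>
      have "t ^ 2 * (1 - t) \<ge> 0" "(t - 3 / 4) ^ 2 \<ge> 0" using t by auto
      then show ?thesis using t by (simp add: power2_eq_square power3_eq_cube algebra_simps)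
    qed
    also have "\<dots> \<le> 125 / 10000 * x ^ 3"
      using t by (intro mult_left_mono power_mono) (auto simp: y_def t_def)
    finally show "\<bar>poly (consecutive_cubic 2) x\<bar> ^ 2 \<le> 125 / 10000 * x ^ 3" by (simp add: p)
  qed (auto simp: power3_eq_cube)
  then show ?thesis by simp
qed

text \<open>The form with coefficients \<open>p1\<close>, \<open>p2\<close> in u + v and u has
  coefficients \<open>p1 + p2\<close>, \<open>p1\<close> in u and v. This substitution is invertible
  and at most doubles the height.\<close>

lemma has_independence_measure_add_left:
  assumes "has_independence_measure u v"
  shows "has_independence_measure (u + v) u"
proof -
  from assms obtain c \<mu> where c: "c > 0" and \<mu>: "\<mu> \<ge> 0" and
    m: "\<And>q p1 p2 :: int. (q, p1, p2) \<noteq> (0, 0, 0) \<Longrightarrow>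
      c * of_int (max \<bar>q\<bar> (max \<bar>p1\<bar> \<bar>p2\<bar>)) powr -\<mu> \<le> \<bar>of_int q + of_int p1 * u + of_int p2 * v\<bar>"
    unfolding has_independence_measure_def by blast
  have "c * 2 powr -\<mu> * of_int (max \<bar>q\<bar> (max \<bar>p1\<bar> \<bar>p2\<bar>)) powr -\<mu>
      \<le> \<bar>of_int q + of_int p1 * (u + v) + of_int p2 * u\<bar>"
    if nz: "(q, p1, p2) \<noteq> (0, 0, 0)" for q p1 p2 :: int
  proof -
    define Q Q' :: real where "Q = of_int (max \<bar>q\<bar> (max \<bar>p1\<bar> \<bar>p2\<bar>))"
      and "Q' = of_int (max \<bar>q\<bar> (max \<bar>p1 + p2\<bar> \<bar>p1\<bar>))"
    have nz': "(q, p1 + p2, p1) \<noteq> (0, 0, 0)" using nz by auto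
    have "0 < max \<bar>q\<bar> (max \<bar>p1 + p2\<bar> \<bar>p1\<bar>)"
      "max \<bar>q\<bar> (max \<bar>p1 + p2\<bar> \<bar>p1\<bar>) \<le> 2 * max \<bar>q\<bar> (max \<bar>p1\<bar> \<bar>p2\<bar>)"
      using nz' by auto
    then have "Q' > 0" "Q' \<le> 2 * Q" unfolding Q_def Q'_def by linarith+
    then have "(2 * Q) powr -\<mu> \<le> Q' powr -\<mu>"
      using \<mu> by (intro powr_mono2') auto
    then have "c * (2 * Q) powr -\<mu> \<le> c * Q' powr -\<mu>" using c by simp
    also have "\<dots> \<le> \<bar>of_int q + of_int p1 * (u + v) + of_int p2 * u\<bar>"
      using m[OF nz'] by (simp add: Q'_def algebra_simps)
    finally show ?thesis unfolding Q_def[symmetric] by (simp add: powr_mult mult.assoc)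
  qed
  moreover have "c * 2 powr -\<mu> > 0" using c by simp
  ultimately show ?thesis unfolding has_independence_measure_def using \<mu> by blast
qed

section \<open>Assembly of the cases and the final bound\<close>

lemma has_independence_measure_consecutive:
  assumes "a > 0"
  shows "has_independence_measure (ln (real a) - ln (real a + 1)) (ln (real a + 1) - ln (real a + 2))"
proof -
  consider "a = 1" | "a = 2" | "a \<ge> 3" using assms by linarith
  then show ?thesis
  proof cases
    case 1
    \<comment> \<open>Hence ln 1 - ln 2 = (ln 2 - ln 3) + (ln 3 - ln 4): the pair for a = 1 is (u +
      v, u), where (u, v) is the pair for a = 2.\<close>
    have "ln (4 :: real) = 2 * ln 2" using ln_realpow[of 2 2] by simp
    then show ?thesis using has_independence_measure_add_left[OF has_independence_measure_of_2] 1 by simp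
  next
    case 2
    then show ?thesis using has_independence_measure_of_2 by simp
  next
    case 3
    then show ?thesis by (rule has_independence_measure_of_ge_3)
  qed
qed

lemma has_independence_measure_imp_independence:
  assumes "has_independence_measure \<theta>1 \<theta>2"
  shows "\<forall>q p1 p2 :: int. of_int q + of_int p1 * \<theta>1 + of_int p2 * \<theta>2 = 0 \<longrightarrow> q = 0 \<and> p1 = 0 \<and> p2 = 0"
    and "\<exists>\<nu>>0. \<exists>Q0::real. \<forall>q p1 p2 :: int. of_int (max \<bar>q\<bar> (max \<bar>p1\<bar> \<bar>p2\<bar>)) \<ge> Q0 \<longrightarrow>
      \<bar>of_int q + of_int p1 * \<theta>1 + of_int p2 * \<theta>2\<bar> > 1 / of_int (max \<bar>q\<bar> (max \<bar>p1\<bar> \<bar>p2\<bar>)) powr \<nu>"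
proof -
  from assms obtain c \<mu> where c: "c > 0" and \<mu>: "\<mu> \<ge> 0" and
    m: "\<And>q p1 p2 :: int. (q, p1, p2) \<noteq> (0, 0, 0) \<Longrightarrow>
      c * of_int (max \<bar>q\<bar> (max \<bar>p1\<bar> \<bar>p2\<bar>)) powr -\<mu> \<le> \<bar>of_int q + of_int p1 * \<theta>1 + of_int p2 * \<theta>2\<bar>"
    unfolding has_independence_measure_def by blast
  show "\<forall>q p1 p2 :: int. of_int q + of_int p1 * \<theta>1 + of_int p2 * \<theta>2 = 0 \<longrightarrow> q = 0 \<and> p1 = 0 \<and> p2 = 0"
  proof (intro allI impI, rule ccontr)
    fix q p1 p2 :: int
    assume z: "of_int q + of_int p1 * \<theta>1 + of_int p2 * \<theta>2 = 0" and nz: "\<not> (q = 0 \<and> p1 = 0 \<and> p2 = 0)"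
    have "real_of_int (max \<bar>q\<bar> (max \<bar>p1\<bar> \<bar>p2\<bar>)) powr -\<mu> > 0" using nz by auto
    then have "c * real_of_int (max \<bar>q\<bar> (max \<bar>p1\<bar> \<bar>p2\<bar>)) powr -\<mu> > 0" using c by (rule mult_pos_pos[rotated])
    then show False using m[of q p1 p2] nz z by simp
  qed
  show "\<exists>\<nu>>0. \<exists>Q0::real. \<forall>q p1 p2 :: int. of_int (max \<bar>q\<bar> (max \<bar>p1\<bar> \<bar>p2\<bar>)) \<ge> Q0 \<longrightarrow>
      \<bar>of_int q + of_int p1 * \<theta>1 + of_int p2 * \<theta>2\<bar> > 1 / of_int (max \<bar>q\<bar> (max \<bar>p1\<bar> \<bar>p2\<bar>)) powr \<nu>"
  \<comment> \<open>The spare power of Q absorbs \<open>c\<close> once Q > 1/c; the summand 1 in the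
    threshold ensures Q > 1, so the triple is nonzero.\<close>
  proof (rule exI[of _ "\<mu> + 1"], intro conjI exI[of _ "1 / c + 1"] allI impI)
    show "\<mu> + 1 > 0" using \<mu> by simp
    fix q p1 p2 :: int
    define Q :: real where "Q = of_int (max \<bar>q\<bar> (max \<bar>p1\<bar> \<bar>p2\<bar>))"
    assume "1 / c + 1 \<le> real_of_int (max \<bar>q\<bar> (max \<bar>p1\<bar> \<bar>p2\<bar>))"
    then have Qc: "1 / c + 1 \<le> Q" by (simp add: Q_def)
    then have Q: "Q > 1 / c" "Q > 1" using c by (auto intro: less_le_trans[of _ "1 / c + 1"])
    have "(q, p1, p2) \<noteq> (0, 0, 0)" using Q(2) by (auto simp: Q_def)
    from m[OF this] have le: "c * Q powr -\<mu> \<le> \<bar>of_int q + of_int p1 * \<theta>1 + of_int p2 * \<theta>2\<bar>"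
      by (simp only: Q_def)
    have "1 / Q powr (\<mu> + 1) = Q powr -\<mu> * (1 / Q)"
      using Q by (simp add: powr_add powr_minus field_simps)
    also have "\<dots> < Q powr -\<mu> * c"
      using Q c by (intro mult_strict_left_mono) (auto simp: field_simps)
    finally show "1 / real_of_int (max \<bar>q\<bar> (max \<bar>p1\<bar> \<bar>p2\<bar>)) powr (\<mu> + 1)
        < \<bar>of_int q + of_int p1 * \<theta>1 + of_int p2 * \<theta>2\<bar>"
      using le unfolding Q_def[symmetric] by (simp only: mult.commute)
  qed
qed

theorem theorem3:
  fixes a :: int
  assumes "a > 0"
  shows "(\<forall>q p1 p2 :: int.
            real_of_int q + real_of_int p1 * ln (real_of_int a / real_of_int (a + 1))
              + real_of_int p2 * ln (real_of_int (a + 1) / real_of_int (a + 2)) = 0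
            \<longrightarrow> q = 0 \<and> p1 = 0 \<and> p2 = 0)
       \<and> (\<exists>\<nu>::real. \<nu> > 0 \<and> (\<exists>Q0::real. \<forall>q p1 p2 :: int.
            real_of_int (max \<bar>q\<bar> (max \<bar>p1\<bar> \<bar>p2\<bar>)) \<ge> Q0 \<longrightarrow>
            \<bar>real_of_int q + real_of_int p1 * ln (real_of_int a / real_of_int (a + 1))
              + real_of_int p2 * ln (real_of_int (a + 1) / real_of_int (a + 2))\<bar>
            > 1 / real_of_int (max \<bar>q\<bar> (max \<bar>p1\<bar> \<bar>p2\<bar>)) powr \<nu>))"
proof -
  obtain n :: nat where n: "a = int n" "n > 0" using assms zero_less_imp_eq_int by blast
  have "ln (real_of_int a / real_of_int (a + 1)) = ln (real n) - ln (real n + 1)"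
    "ln (real_of_int (a + 1) / real_of_int (a + 2)) = ln (real n + 1) - ln (real n + 2)"
    using n by (simp_all add: ln_div)
  then show ?thesis using has_independence_measure_imp_independence[OF has_independence_measure_consecutive[OF n(2)]] by simp
qed

end
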